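(* Let $\mathcal{C}_1,\mathcal{C}_2\subseteq \mathbb{Z}_2^{\alpha}\times\mathbb{Z}_4^{\beta}$ be any two additive codes of dual type $(\alpha,\beta;\gamma_1,\delta_1;\kappa_1)$ and $(\alpha,\beta;\gamma_2,\delta_2;\kappa_2)$, respectively, and let $\eta(\mathcal{C}_1,\mathcal{C}_2)=|\mathcal{C}_1\cap\mathcal{C}_2|$. Then $$2^{\alpha+2\beta-\mu}\;\leq\;\eta(\mathcal{C}_1,\mathcal{C}_2)\;\leq\; 2^{\alpha+2\beta-\max(\kappa_1+\delta_1,\kappa_2+\delta_2)-\max(\delta_1,\delta_2)},$$ where $$\mu=\min\big(\gamma_1+\gamma_2+2(\delta_1+\delta_2),\ \gamma_1+\gamma_2+\delta_1+\delta_2+\beta,\ \delta_1+\delta_2+\alpha+\beta,\ \alpha+2\beta\big).$$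
   Context: An additive code is a subgroup $\mathcal{C}$ of $\mathbb{Z}_2^{\alpha}\times\mathbb{Z}_4^{\beta}$ ($\alpha,\beta\ge 0$ integers). It is of type $(\alpha,\beta;\gamma,\delta;\kappa)$ if $\mathcal{C}\cong\mathbb{Z}_2^{\gamma}\times\mathbb{Z}_4^{\delta}$ as a group, and $\kappa$ is the dimension over $\mathbb{Z}_2$ of the projection to the $\alpha$ binary coordinates of the subgroup $\{c\in\mathcal{C}: 2c=0\}$ ($\kappa=0$ if $\alpha=0$). The inner product on $\mathbb{Z}_2^{\alpha}\times\mathbb{Z}_4^{\beta}$ is $\langle u,v\rangle=2\big(\sum_{i=1}^{\alpha}u_iv_i\big)+\sum_{j=\alpha+1}^{\alpha+\beta}u_jv_j\in\mathbb{Z}_4$, and the additive dual code is $\mathcal{C}^\perp=\{u:\langle u,v\rangle=0 \text{ for all } v\in\mathcal{C}\}$. The code $\mathcal{C}$ is of dual type $(\alpha,\beta;\gamma,\delta;\kappa)$ if $\mathcal{C}^\perp$ is of type $(\alpha,\beta;\gamma,\delta;\kappa)$. *)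

theory Defs
  imports
    Complex_Main
    "HOL-Algebra.Group"
    "HOL-Library.Z2"
    "HOL-Library.Numeral_Type"
    "HOL-Library.Function_Algebras"
    "HOL-Library.Product_Plus"
begin

text \<open>
  A vector of length \<open>n\<close> is a function on \<open>nat\<close> that vanishes at all indices \<open>i \<ge> n\<close>, so that
  the lengths \<open>\<alpha>\<close> and \<open>\<beta>\<close> are ordinary natural numbers and may be \<open>0\<close>. The field with two elements
  is the type \<open>bit\<close>, and the ring of integers modulo 4 is the numeral type \<open>4\<close>. Both blocks of
  coordinates are indexed from \<open>0\<close>.
\<close>

type_synonym z2z4_vec = "(nat \<Rightarrow> bit) \<times> (nat \<Rightarrow> 4)"

definition Z2Z4 :: "nat \<Rightarrow> nat \<Rightarrow> z2z4_vec monoid" where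
  "Z2Z4 \<alpha> \<beta> = \<lparr>carrier = {(u, v). (\<forall>i\<ge>\<alpha>. u i = 0) \<and> (\<forall>j\<ge>\<beta>. v j = 0)},
               mult = (+), one = 0\<rparr>"

lemma comm_group_Z2Z4: "comm_group (Z2Z4 \<alpha> \<beta>)"
proof (rule comm_groupI)
  fix x assume "x \<in> carrier (Z2Z4 \<alpha> \<beta>)"
  then show "\<exists>y\<in>carrier (Z2Z4 \<alpha> \<beta>). y \<otimes>\<^bsub>Z2Z4 \<alpha> \<beta>\<^esub> x = \<one>\<^bsub>Z2Z4 \<alpha> \<beta>\<^esub>"
    by (intro bexI[of _ "- x"]) (auto simp: Z2Z4_def)
qed (auto simp: Z2Z4_def add_ac zero_prod_def)

abbreviation additive_code :: "nat \<Rightarrow> nat \<Rightarrow> z2z4_vec set \<Rightarrow> bool" where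
  "additive_code \<alpha> \<beta> C \<equiv> subgroup C (Z2Z4 \<alpha> \<beta>)"

interpretation bitvec: vector_space "\<lambda>(c::bit) (u::nat \<Rightarrow> bit) i. c * u i"
  by unfold_locales (auto simp: fun_eq_iff algebra_simps)

text \<open>
  For \<open>\<alpha> = 0\<close> the projection below is the zero space, so \<open>\<kappa> = 0\<close> without a separate clause.
\<close>

definition has_type ::
  "nat \<Rightarrow> nat \<Rightarrow> z2z4_vec set \<Rightarrow> nat \<Rightarrow> nat \<Rightarrow> nat \<Rightarrow> bool" where
  "has_type \<alpha> \<beta> C \<gamma> \<delta> \<kappa> \<longleftrightarrow>
     additive_code \<alpha> \<beta> C \<and>
     (Z2Z4 \<alpha> \<beta>)\<lparr>carrier := C\<rparr> \<cong> Z2Z4 \<gamma> \<delta> \<and>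
     \<kappa> = bitvec.dim (fst ` {c \<in> C. c + c = 0})"

text \<open>
  The term \<open>2 * of_bool (b = 1)\<close> is the image of \<open>b\<close> under the embedding of the integers modulo 2
  into the integers modulo 4 given by multiplication by 2.
\<close>

definition z2z4_inner :: "nat \<Rightarrow> nat \<Rightarrow> z2z4_vec \<Rightarrow> z2z4_vec \<Rightarrow> 4" where
  "z2z4_inner \<alpha> \<beta> x y =
     2 * (\<Sum>i<\<alpha>. of_bool (fst x i * fst y i = 1)) + (\<Sum>j<\<beta>. snd x j * snd y j)"

definition additive_dual :: "nat \<Rightarrow> nat \<Rightarrow> z2z4_vec set \<Rightarrow> z2z4_vec set" where
  "additive_dual \<alpha> \<beta> C =
     {x \<in> carrier (Z2Z4 \<alpha> \<beta>). \<forall>y\<in>C. z2z4_inner \<alpha> \<beta> x y = 0}"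

definition has_dual_type ::
  "nat \<Rightarrow> nat \<Rightarrow> z2z4_vec set \<Rightarrow> nat \<Rightarrow> nat \<Rightarrow> nat \<Rightarrow> bool" where
  "has_dual_type \<alpha> \<beta> C \<gamma> \<delta> \<kappa> \<longleftrightarrow> has_type \<alpha> \<beta> (additive_dual \<alpha> \<beta> C) \<gamma> \<delta> \<kappa>"

definition intersection_number :: "z2z4_vec set \<Rightarrow> z2z4_vec set \<Rightarrow> nat" where
  "intersection_number C D = card (C \<inter> D)"

end

theory Submission imports Defs begin

text \<open>
  Let \<open>D\<^sub>1, D\<^sub>2\<close> be the duals and \<open>S = D\<^sub>1 + D\<^sub>2\<close>, so that the dual of \<open>S\<close> is the intersection of the codes and
  has \<open>2 ^ (\<alpha> + 2 * \<beta>) / card S\<close> elements. Doubling is an endomorphism of \<open>S\<close>, hence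
  \<open>card S = card (2 S) * card (S[2])\<close>, with \<open>S[2]\<close> the elements \<open>x\<close> such that \<open>2 x = 0\<close>. The four terms of \<open>\<mu>\<close>
  arise from combining the bounds \<open>\<delta>\<^sub>1 + \<delta>\<^sub>2\<close> and \<open>\<beta>\<close> for the dimension of \<open>2 S\<close> with the bounds
  \<open>\<gamma>\<^sub>1 + \<delta>\<^sub>1 + \<gamma>\<^sub>2 + \<delta>\<^sub>2\<close> and \<open>\<alpha> + \<beta>\<close> for that of \<open>S[2]\<close>. Conversely \<open>2 S\<close> contains \<open>2 D\<^sub>i\<close>, of
  dimension \<open>\<delta>\<^sub>i\<close>, and \<open>S[2]\<close> contains \<open>D\<^sub>i[2]\<close>, of dimension at least \<open>\<kappa>\<^sub>i + \<delta>\<^sub>i\<close> because \<open>2 D\<^sub>i\<close> lies in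
  the kernel of its projection to the binary coordinates.
\<close>

section \<open>Subgroups of abelian groups and counting along homomorphisms\<close>

text \<open>The vectors, and pairs of vectors, form types of class \<open>ab_group_add\<close>, so
  sums, products and images of codes can be handled without carrier structures. The lengths enter
  only through inclusion in the carrier.\<close>

definition add_subgroup :: "'a::ab_group_add set \<Rightarrow> bool" where
  "add_subgroup S \<longleftrightarrow> 0 \<in> S \<and> (\<forall>x\<in>S. \<forall>y\<in>S. x - y \<in> S)"

lemma add_subgroup_zero: "add_subgroup S \<Longrightarrow> 0 \<in> S"
  and add_subgroup_diff: "add_subgroup S \<Longrightarrow> x \<in> S \<Longrightarrow> y \<in> S \<Longrightarrow> x - y \<in> S"
  by (auto simp: add_subgroup_def)

lemma add_subgroup_minus: "add_subgroup S \<Longrightarrow> x \<in> S \<Longrightarrow> - x \<in> S"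
  using add_subgroup_diff[of S 0 x] add_subgroup_zero by auto

lemma add_subgroup_add: "add_subgroup S \<Longrightarrow> x \<in> S \<Longrightarrow> y \<in> S \<Longrightarrow> x + y \<in> S"
  using add_subgroup_diff[of S x "- y"] add_subgroup_minus by auto

lemma add_subgroup_Times: "add_subgroup S \<Longrightarrow> add_subgroup T \<Longrightarrow> add_subgroup (S \<times> T)"
  by (auto simp: add_subgroup_def zero_prod_def)

lemma add_subgroup_image:
  assumes "additive f" "add_subgroup S"
  shows "add_subgroup (f ` S)"
proof -
  interpret additive f by fact
  show ?thesis
    unfolding add_subgroup_def
  proof (intro conjI ballI)
    show "0 \<in> f ` S"
      using add_subgroup_zero[OF assms(2)] zero by (metis imageI)
    show "x - y \<in> f ` S" if "x \<in> f ` S" "y \<in> f ` S" for x y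
      using that add_subgroup_diff[OF assms(2)] by (auto simp flip: diff)
  qed
qed

lemma add_subgroup_kernel:
  "additive f \<Longrightarrow> add_subgroup S \<Longrightarrow> add_subgroup {x\<in>S. f x = 0}"
  by (simp add: add_subgroup_def additive.zero additive.diff)

lemma additive_double: "additive (\<lambda>x. x + x)"
  by unfold_locales (simp add: ac_simps)

text \<open>Every fibre over the image is a coset of the kernel: translation by one of its points
  maps it bijectively onto the kernel.\<close>

lemma card_add_subgroup_hom:
  assumes "additive f" "add_subgroup S" "finite S"
  shows "card S = card (f ` S) * card {x\<in>S. f x = 0}"
proof -
  interpret additive f by fact
  have fibre: "card {x\<in>S. f x = y} = card {x\<in>S. f x = 0}" if "y \<in> f ` S" for y
  proof -
    from that obtain a where a: "a \<in> S" "y = f a" by auto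
    have "bij_betw (\<lambda>x. x - a) {x\<in>S. f x = y} {x\<in>S. f x = 0}"
      by (rule bij_betw_byWitness[where f' = "\<lambda>x. x + a"])
         (use a assms(2) in \<open>auto simp: add diff add_subgroup_add add_subgroup_diff\<close>)
    then show ?thesis by (rule bij_betw_same_card)
  qed
  have "card S = (\<Sum>y\<in>f ` S. card {x\<in>S. f x = y})"
    using sum.image_gen[OF assms(3), of "\<lambda>_. 1::nat" f] by simp
  also have "\<dots> = card (f ` S) * card {x\<in>S. f x = 0}"
    using fibre by simp
  finally show ?thesis .
qed

section \<open>Doubles and two-torsion\<close>

abbreviation two_torsion :: "'a::ab_group_add set \<Rightarrow> 'a set" where
  "two_torsion S \<equiv> {x\<in>S. x + x = 0}"

abbreviation doubles :: "'a::ab_group_add set \<Rightarrow> 'a set" where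
  "doubles S \<equiv> (\<lambda>x. x + x) ` S"

lemma card_two_torsion_mono:
  "S \<subseteq> T \<Longrightarrow> finite T \<Longrightarrow> card (two_torsion S) \<le> card (two_torsion T)"
  by (auto intro!: card_mono)

lemma card_doubles_mono: "S \<subseteq> T \<Longrightarrow> finite T \<Longrightarrow> card (doubles S) \<le> card (doubles T)"
  by (auto intro!: card_mono)

lemma card_doubles_two_torsion:
  assumes "add_subgroup S" "finite S"
  shows "card S = card (doubles S) * card (two_torsion S)"
  using card_add_subgroup_hom[OF additive_double assms] .

lemma doubles_image:
  assumes "additive f"
  shows "doubles (f ` S) = f ` doubles S"
  using assms by (auto simp: additive.add image_image)

text \<open>The number of two-torsion elements is the index of the doubles, and the index
  of a subgroup does not grow under homomorphisms.\<close>

lemma card_two_torsion_image_le: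
  assumes f: "additive f" and S: "add_subgroup S" "finite S"
  shows "card (two_torsion (f ` S)) \<le> card (two_torsion S)"
proof -
  let ?K = "{x\<in>S. f x = 0}" and ?L = "{x\<in>doubles S. f x = 0}"
  have dS: "add_subgroup (doubles S)" "finite (doubles S)"
    using add_subgroup_image[OF additive_double] S by auto
  have fS: "add_subgroup (f ` S)" "finite (f ` S)"
    using add_subgroup_image[OF f] S by auto
  \<comment> \<open>Doubles of elements of \<open>S\<close> lie in \<open>S\<close>, so
    \<open>?L\<close> is a subset of \<open>?K\<close>.\<close>
  have "card ?L \<le> card ?K"
    using S by (intro card_mono) (auto simp: add_subgroup_add)
  have pos: "card ?K > 0" "card (f ` doubles S) > 0"
    using S f dS add_subgroup_image[OF f]
    by (auto simp: card_gt_0_iff additive.zero add_subgroup_zero intro!: exI[of _ 0])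
       (use add_subgroup_zero in blast)+
  \<comment> \<open>Counting \<open>S\<close> through \<open>f\<close> and then doubling, or through
    doubling and then \<open>f\<close>, produces the same factor, the size of the image of
    \<open>doubles S\<close>. It cancels at the end together with \<open>card ?K\<close>, which
    bounds \<open>card ?L\<close>.\<close>
  have "card (f ` doubles S) * card ?K * card (two_torsion (f ` S)) = card (f ` S) * card ?K"
    using card_doubles_two_torsion[OF fS] doubles_image[OF f, of S] by simp
  also have "\<dots> = card S"
    using card_add_subgroup_hom[OF f S] by simp
  also have "\<dots> = card (f ` doubles S) * card ?L * card (two_torsion S)"
    using card_doubles_two_torsion[OF S] card_add_subgroup_hom[OF f dS] by simp
  also have "\<dots> \<le> card (f ` doubles S) * card ?K * card (two_torsion S)"
    using \<open>card ?L \<le> card ?K\<close> by simp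
  finally show ?thesis
    using pos by simp
qed

lemma two_torsion_Times: "two_torsion (S \<times> T) = two_torsion S \<times> two_torsion T"
  by (auto simp: zero_prod_def)

lemma doubles_Times: "doubles (S \<times> T) = doubles S \<times> doubles T"
  by (auto simp: image_iff)

lemma additive_sum: "additive (\<lambda>(x, y). x + y)"
  by unfold_locales (auto simp: ac_simps)

lemma subset_sum_image:
  fixes D E :: "'a::ab_group_add set"
  assumes "0 \<in> D" "0 \<in> E"
  shows "D \<subseteq> (\<lambda>(x, y). x + y) ` (D \<times> E)" and "E \<subseteq> (\<lambda>(x, y). x + y) ` (D \<times> E)"
  using assms by (force simp: image_iff)+

lemma sum_image_subset:
  "add_subgroup G \<Longrightarrow> D \<subseteq> G \<Longrightarrow> E \<subseteq> G \<Longrightarrow> (\<lambda>(x, y). x + y) ` (D \<times> E) \<subseteq> G"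
  by (auto intro!: add_subgroup_add)

section \<open>The size of the ambient group and of its two-torsion\<close>

lemma UNIV_4: "(UNIV::4 set) = {0,1,2,3}"
  by (rule card_subset_eq[symmetric]) auto

lemma four_cases:
  fixes a :: 4
  obtains "a = 0" | "a = 1" | "a = 2" | "a = 3"
  using UNIV_4 by blast

lemma UNIV_bit: "(UNIV::bit set) = {0,1}"
  by auto

lemma finite_UNIV_bit: "finite (UNIV::bit set)" and card_UNIV_bit: "CARD(bit) = 2"
  by (simp_all add: UNIV_bit)

lemma double_eq_0_iff_4: "(a::4) + a = 0 \<longleftrightarrow> a \<in> {0, 2}"
  by (cases a rule: four_cases) auto

text \<open>Restriction to the first \<open>n\<close> indices identifies these vectors with the
  extensional functions into \<open>A\<close>; the inverse is extension by zero.\<close>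

lemma card_funs_bounded:
  fixes A :: "'a::zero set"
  assumes "finite A"
  shows "card {u. (\<forall>i<n. u i \<in> A) \<and> (\<forall>i\<ge>n. u i = 0)} = card A ^ n" (is "card ?V = _")
    and "finite {u. (\<forall>i<n. u i \<in> A) \<and> (\<forall>i\<ge>n. u i = 0)}"
proof -
  have bij: "bij_betw (\<lambda>u. restrict u {..<n}) ?V ({..<n} \<rightarrow>\<^sub>E A)"
  proof (rule bij_betw_byWitness[where f' = "\<lambda>u i. if i < n then u i else 0"])
    show "\<forall>u\<in>?V. (\<lambda>i. if i < n then restrict u {..<n} i else 0) = u"
      by (auto simp: fun_eq_iff)
    show "\<forall>u\<in>{..<n} \<rightarrow>\<^sub>E A. restrict (\<lambda>i. if i < n then u i else 0) {..<n} = u"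
      by (auto simp: fun_eq_iff PiE_iff extensional_def)
    show "(\<lambda>u. restrict u {..<n}) ` ?V \<subseteq> {..<n} \<rightarrow>\<^sub>E A"
      by (rule image_subsetI) (simp add: restrict_PiE_iff)
    show "(\<lambda>u i. if i < n then u i else 0) ` ({..<n} \<rightarrow>\<^sub>E A) \<subseteq> ?V"
      by (rule image_subsetI) (simp add: PiE_iff)
  qed
  show "card ?V = card A ^ n"
    unfolding bij_betw_same_card[OF bij] by (simp add: card_funcsetE)
  show "finite ?V"
    unfolding bij_betw_finite[OF bij] using assms by (simp add: finite_PiE)
qed

text \<open>Membership in \<open>UNIV\<close> brings each block into the shape counted by
  \<open>card_funs_bounded\<close>.\<close>

lemma carrier_Z2Z4_eq:
  "carrier (Z2Z4 \<alpha> \<beta>) =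
     {u. (\<forall>i<\<alpha>. u i \<in> UNIV) \<and> (\<forall>i\<ge>\<alpha>. u i = 0)} \<times> {v. (\<forall>i<\<beta>. v i \<in> UNIV) \<and> (\<forall>i\<ge>\<beta>. v i = 0)}"
  by (auto simp: Z2Z4_def)

lemma finite_carrier_Z2Z4: "finite (carrier (Z2Z4 \<alpha> \<beta>))"
  unfolding carrier_Z2Z4_eq by (intro finite_cartesian_product card_funs_bounded) (auto simp: finite_UNIV_bit)

lemma card_carrier_Z2Z4: "card (carrier (Z2Z4 \<alpha> \<beta>)) = 2 ^ (\<alpha> + 2 * \<beta>)"
  unfolding carrier_Z2Z4_eq card_cartesian_product
  by (subst (1 2) card_funs_bounded) (auto simp: finite_UNIV_bit card_UNIV_bit power_add power_mult)

text \<open>Doubling kills every binary entry, and a quaternary entry exactly when it is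
  even.\<close>

lemma two_torsion_Z2Z4_eq:
  "two_torsion (carrier (Z2Z4 \<alpha> \<beta>)) =
     {u. (\<forall>i<\<alpha>. u i \<in> UNIV) \<and> (\<forall>i\<ge>\<alpha>. u i = 0)} \<times> {v. (\<forall>i<\<beta>. v i \<in> {0, 2}) \<and> (\<forall>i\<ge>\<beta>. v i = 0)}"
    (is "?T = ?U \<times> ?V")
proof -
  have u: "u + u = 0" for u :: "nat \<Rightarrow> bit"
    by (auto simp: fun_eq_iff)
  have v: "v + v = 0 \<longleftrightarrow> (\<forall>i. v i \<in> {0, 2})" for v :: "nat \<Rightarrow> 4"
    unfolding fun_eq_iff plus_fun_apply zero_fun_apply double_eq_0_iff_4 ..
  have "v \<in> ?V \<longleftrightarrow> (\<forall>i\<ge>\<beta>. v i = 0) \<and> v + v = 0" for v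
    unfolding v mem_Collect_eq by (metis insertI1 not_less)
  moreover have "u \<in> ?U \<longleftrightarrow> (\<forall>i\<ge>\<alpha>. u i = 0)" for u
    by simp
  moreover have "(a, b) \<in> ?T \<longleftrightarrow> ((\<forall>i\<ge>\<alpha>. a i = 0) \<and> (\<forall>i\<ge>\<beta>. b i = 0)) \<and> b + b = 0" for a b
    by (simp only: Z2Z4_def zero_prod_def plus_prod_def fst_conv snd_conv prod.inject mem_Collect_eq
        case_prod_conv partial_object.simps u simp_thms)
  ultimately have ab: "(a, b) \<in> ?T \<longleftrightarrow> a \<in> ?U \<and> b \<in> ?V" for a b
    by (simp only: conj_assoc)
  show ?thesis
  proof (rule Set.set_eqI)
    show "x \<in> ?T \<longleftrightarrow> x \<in> ?U \<times> ?V" for x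
      using ab[of "fst x" "snd x"] unfolding mem_Times_iff prod.collapse .
  qed
qed

lemma card_two_torsion_Z2Z4: "card (two_torsion (carrier (Z2Z4 \<alpha> \<beta>))) = 2 ^ (\<alpha> + \<beta>)"
proof -
  have "finite {0, 2::4}" "card {0, 2::4} = 2"
    by simp_all
  then show ?thesis
    unfolding two_torsion_Z2Z4_eq card_cartesian_product
    by (simp only: card_funs_bounded(1) finite_UNIV_bit card_UNIV_bit power_add)
qed

section \<open>Additive codes as subgroups of the vector type\<close>

lemma mult_Z2Z4 [simp]: "x \<otimes>\<^bsub>Z2Z4 \<alpha> \<beta>\<^esub> y = x + y"
  and one_Z2Z4 [simp]: "\<one>\<^bsub>Z2Z4 \<alpha> \<beta>\<^esub> = 0"
  by (auto simp: Z2Z4_def)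

text \<open>All entries are annihilated by 4. Negation thus becomes a sum, available from closure
  under addition.\<close>

lemma minus_eq_triple: "- x = x + x + (x :: z2z4_vec)"
proof -
  have "- b = b + b + b" for b :: bit
    by (cases b) auto
  moreover have "- a = a + a + a" for a :: 4
    by (cases a rule: four_cases) auto
  ultimately show ?thesis
    by (auto simp: prod_eq_iff fun_eq_iff)
qed

lemma additive_code_iff:
  "additive_code \<alpha> \<beta> C \<longleftrightarrow> C \<subseteq> carrier (Z2Z4 \<alpha> \<beta>) \<and> add_subgroup C"
proof
  assume C: "additive_code \<alpha> \<beta> C"
  then interpret subgroup C "Z2Z4 \<alpha> \<beta>" .
  have "- x \<in> C" if "x \<in> C" for x
    using minus_eq_triple[of x] m_closed that by (metis mult_Z2Z4)
  then have "x - y \<in> C" if "x \<in> C" "y \<in> C" for x y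
    using m_closed[OF that(1), of "- y"] that by simp
  then show "C \<subseteq> carrier (Z2Z4 \<alpha> \<beta>) \<and> add_subgroup C"
    using subset one_closed by (auto simp: add_subgroup_def)
next
  assume C: "C \<subseteq> carrier (Z2Z4 \<alpha> \<beta>) \<and> add_subgroup C"
  interpret comm_group "Z2Z4 \<alpha> \<beta>" by (rule comm_group_Z2Z4)
  show "additive_code \<alpha> \<beta> C"
  proof (rule subgroupI)
    show "inv\<^bsub>Z2Z4 \<alpha> \<beta>\<^esub> x \<in> C" if "x \<in> C" for x
    proof -
      have "inv\<^bsub>Z2Z4 \<alpha> \<beta>\<^esub> x = - x"
        using C that add_subgroup_minus by (intro inv_equality) (auto)
      then show ?thesis using C that add_subgroup_minus by auto
    qed
  qed (use C add_subgroup_zero add_subgroup_add in auto)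
qed

lemma add_subgroup_carrier: "add_subgroup (carrier (Z2Z4 \<alpha> \<beta>))"
  by (auto simp: add_subgroup_def Z2Z4_def zero_prod_def)

lemma double_double_eq_0: "x + x + (x + x) = (0 :: z2z4_vec)"
proof -
  have "x + x + (x + x) = x + (x + x + x)"
    by (simp only: add.assoc)
  also have "\<dots> = 0"
    unfolding minus_eq_triple[symmetric] by simp
  finally show ?thesis .
qed

text \<open>The binary length \<open>0\<close> on the right records that doubling kills the binary
  entries; the bound \<open>2 ^ \<beta>\<close> on the number of doubles comes from here.\<close>

lemma doubles_carrier_subset:
  "doubles (carrier (Z2Z4 \<alpha> \<beta>)) \<subseteq> two_torsion (carrier (Z2Z4 0 \<beta>))"
  using double_double_eq_0 by (auto simp: Z2Z4_def)

section \<open>Cardinalities determined by the type\<close>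

text \<open>Distinct subsets of a basis have distinct sums, and all these sums lie in
  \<open>V\<close>. An inequality suffices because \<open>\<kappa>\<close> only enters a lower bound
  on the two-torsion.\<close>

lemma two_power_dim_le_card:
  assumes "add_subgroup V" "finite V"
  shows "2 ^ bitvec.dim V \<le> card V"
proof -
  obtain B where B: "B \<subseteq> V" "bitvec.independent B" "card B = bitvec.dim V"
    using bitvec.basis_exists[of V] by metis
  have fin: "finite B"
    using B(1) assms(2) finite_subset by blast
  have "inj_on (\<lambda>A. \<Sum>A) (Pow B)"
  proof (rule inj_onI)
    fix X Y assume XY: "X \<in> Pow B" "Y \<in> Pow B" and eq: "\<Sum>X = \<Sum>Y"
    \<comment> \<open>The indicator function of a subset turns its sum into a linear combination, so
      independence applies to the difference of two subset sums.\<close>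
    define c :: "(nat \<Rightarrow> bit) set \<Rightarrow> (nat \<Rightarrow> bit) \<Rightarrow> bit" where "c A b = (if b \<in> A then 1 else 0)" for A b
    have sum_eq: "\<Sum>A = (\<Sum>b\<in>B. (\<lambda>i. c A b * b i))" if "A \<subseteq> B" for A
    proof -
      have "\<Sum>A = (\<Sum>b\<in>B. if b \<in> A then b else 0)"
        using that fin by (simp add: sum.If_cases Int_absorb1)
      also have "\<dots> = (\<Sum>b\<in>B. (\<lambda>i. c A b * b i))"
        by (intro sum.cong) (auto simp: fun_eq_iff c_def)
      finally show ?thesis .
    qed
    have "(\<Sum>b\<in>B. (\<lambda>i. (c X b - c Y b) * b i)) = (\<Sum>b\<in>B. (\<lambda>i. c X b * b i) - (\<lambda>i. c Y b * b i))"
      by (simp only: fun_diff_def left_diff_distrib)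
    also have "\<dots> = 0"
      using XY eq by (simp add: sum_subtractf sum_eq)
    finally have "c X b - c Y b = 0" if "b \<in> B" for b
      using bitvec.independentD[OF B(2) fin order_refl _ that, of "\<lambda>b. c X b - c Y b"] by simp
    then have "c X b = c Y b" if "b \<in> B" for b
      using that by (metis right_minus_eq)
    then have "b \<in> X \<longleftrightarrow> b \<in> Y" if "b \<in> B" for b
      using that unfolding c_def by (metis zero_neq_one)
    then show "X = Y" using XY by auto
  qed
  moreover have "\<Sum>A \<in> V" if "A \<subseteq> B" for A
    using finite_subset[OF that fin] that
  proof (induction A rule: finite_induct)
    case (insert b A)
    then have "b + \<Sum>A \<in> V"
      using B(1) by (intro add_subgroup_add[OF assms(1)]) auto
    then show ?case
      unfolding sum.insert[OF insert.hyps] .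
  qed (use assms add_subgroup_zero in auto)
  ultimately have "card (Pow B) \<le> card V"
    using assms(2) by (intro card_inj_on_le[of "\<lambda>A. \<Sum>A"]) auto
  then show ?thesis
    using B(3) fin by (simp add: card_Pow)
qed

text \<open>An isomorphism transports the sizes of the group and of its two-torsion from the
  standard group; the number of doubles is their quotient. For \<open>\<kappa>\<close>, the
  two-torsion is counted along the binary projection, whose kernel contains the doubles.\<close>

lemma
  assumes "has_type \<alpha> \<beta> D \<gamma> \<delta> \<kappa>"
  shows has_type_card: "card D = 2 ^ (\<gamma> + 2 * \<delta>)"
    and has_type_card_two_torsion: "card (two_torsion D) = 2 ^ (\<gamma> + \<delta>)"
    and has_type_card_doubles: "card (doubles D) = 2 ^ \<delta>"
    and has_type_kappa: "2 ^ (\<kappa> + \<delta>) \<le> card (two_torsion D)"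
proof -
  have D: "D \<subseteq> carrier (Z2Z4 \<alpha> \<beta>)" "add_subgroup D"
    using assms by (auto simp: has_type_def additive_code_iff)
  have fin: "finite D"
    using D(1) finite_carrier_Z2Z4 finite_subset by blast
  obtain \<phi> where hom: "\<phi> \<in> hom ((Z2Z4 \<alpha> \<beta>)\<lparr>carrier := D\<rparr>) (Z2Z4 \<gamma> \<delta>)"
    and bij: "bij_betw \<phi> D (carrier (Z2Z4 \<gamma> \<delta>))"
    using assms by (auto simp: has_type_def is_iso_def iso_def)
  show card: "card D = 2 ^ (\<gamma> + 2 * \<delta>)"
    using bij_betw_same_card[OF bij] card_carrier_Z2Z4 by simp
  have add: "\<phi> (x + y) = \<phi> x + \<phi> y" if "x \<in> D" "y \<in> D" for x y
    using hom_mult[OF hom, of x y] that by simp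
  have "\<phi> 0 = 0"
    using add[of 0 0] add_subgroup_zero[OF D(2)] by simp
  \<comment> \<open>Since \<open>\<phi> (x + x) = \<phi> x + \<phi> x\<close>, the forward direction
    is injectivity of \<open>\<phi>\<close> at \<open>x + x\<close> and \<open>0\<close>.\<close>
  then have "\<phi> x + \<phi> x = 0 \<longleftrightarrow> x + x = 0" if "x \<in> D" for x
    using add[OF that that] that add_subgroup_add[OF D(2) that that] add_subgroup_zero[OF D(2)]
      bij_betw_imp_inj_on[OF bij] by (metis inj_onD)
  then have "bij_betw \<phi> (two_torsion D) (two_torsion (carrier (Z2Z4 \<gamma> \<delta>)))"
    using bij by (intro bij_betw_Collect) auto
  from bij_betw_same_card[OF this]
  show tors: "card (two_torsion D) = 2 ^ (\<gamma> + \<delta>)"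
    by (simp only: card_two_torsion_Z2Z4)
  show doub: "card (doubles D) = 2 ^ \<delta>"
    using card_doubles_two_torsion[OF D(2) fin] card tors by (simp add: power_add mult_2)
  have T: "add_subgroup (two_torsion D)" "finite (two_torsion D)"
    using add_subgroup_kernel[OF additive_double D(2)] fin by simp_all
  have fst: "additive (fst :: z2z4_vec \<Rightarrow> _)"
    by unfold_locales auto
  have "2 ^ \<kappa> \<le> card (fst ` two_torsion D)"
    using two_power_dim_le_card[OF add_subgroup_image[OF fst T(1)]] T(2) assms
    by (simp add: has_type_def)
  moreover have "doubles D \<subseteq> {x\<in>two_torsion D. fst x = 0}"
  proof
    fix y assume "y \<in> doubles D"
    then obtain x where x: "x \<in> D" "y = x + x"
      by blast
    have "fst (x + x) = 0"
      by (simp add: fun_eq_iff)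
    then show "y \<in> {x\<in>two_torsion D. fst x = 0}"
      unfolding x(2) using add_subgroup_add[OF D(2) x(1) x(1)] double_double_eq_0[of x] by blast
  qed
  then have "2 ^ \<delta> \<le> card {x\<in>two_torsion D. fst x = 0}"
    unfolding doub[symmetric] using fin by (intro card_mono) simp_all
  ultimately show "2 ^ (\<kappa> + \<delta>) \<le> card (two_torsion D)"
    unfolding card_add_subgroup_hom[OF fst T] power_add by (rule mult_le_mono)
qed

section \<open>The inner product and character sums\<close>

lemma z2z4_inner_commute: "z2z4_inner \<alpha> \<beta> x y = z2z4_inner \<alpha> \<beta> y x"
  by (simp only: z2z4_inner_def mult.commute)

lemma additive_z2z4_inner: "additive (\<lambda>x. z2z4_inner \<alpha> \<beta> x y)"
proof
  fix x x' :: z2z4_vec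
  \<comment> \<open>The embedding of the integers modulo 2 is additive because 2 + 2 = 0 modulo 4,
    although \<open>of_bool\<close> alone is not additive.\<close>
  have *: "2 * of_bool (a + b = 1) = 2 * of_bool (a = 1) + (2 * of_bool (b = 1) :: 4)" for a b :: bit
    by (cases a; cases b) auto
  show "z2z4_inner \<alpha> \<beta> (x + x') y = z2z4_inner \<alpha> \<beta> x y + z2z4_inner \<alpha> \<beta> x' y"
    by (simp only: z2z4_inner_def fst_add snd_add plus_fun_apply distrib_right
        sum_distrib_left * sum.distrib add_ac)
qed

text \<open>The witness is the unit vector at a nonzero coordinate of \<open>y\<close>: the product
  is 2 for a binary coordinate and the entry itself for a quaternary one.\<close>

lemma z2z4_inner_nondegenerate:
  assumes "y \<in> carrier (Z2Z4 \<alpha> \<beta>)" "y \<noteq> 0"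
  obtains x where "x \<in> carrier (Z2Z4 \<alpha> \<beta>)" "z2z4_inner \<alpha> \<beta> x y \<noteq> 0"
proof -
  from assms(2) consider i where "fst y i \<noteq> 0" | j where "snd y j \<noteq> 0"
    by (auto simp: prod_eq_iff fun_eq_iff)
  then show thesis
  proof cases
    case 1
    then have i: "i < \<alpha>"
      using assms(1) by (auto simp: Z2Z4_def not_less[symmetric])
    let ?x = "(\<lambda>k. of_bool (k = i), 0) :: z2z4_vec"
    have "of_bool (fst ?x k * fst y k = 1) = (if k = i then 1 else 0 :: 4)" for k
      using 1 by (cases "k = i") auto
    then have "z2z4_inner \<alpha> \<beta> ?x y = 2 * (\<Sum>k<\<alpha>. if k = i then 1 else 0)"
      by (simp only: z2z4_inner_def) simp
    also have "\<dots> = 2"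
      using i by simp
    finally show thesis
      using i by (intro that[of ?x]) (auto simp: Z2Z4_def)
  next
    case 2
    then have j: "j < \<beta>"
      using assms(1) by (auto simp: Z2Z4_def not_less[symmetric])
    let ?x = "(0, \<lambda>k. of_bool (k = j)) :: z2z4_vec"
    have "z2z4_inner \<alpha> \<beta> ?x y = (\<Sum>k<\<beta>. if k = j then snd y k else 0)"
      by (auto simp: z2z4_inner_def intro!: sum.cong)
    also have "\<dots> = snd y j"
      using j by simp
    finally show thesis
      using 2 j by (intro that[of ?x]) (auto simp: Z2Z4_def)
  qed
qed

text \<open>The real part of the character \<open>a \<mapsto> \<i>\<^sup>a\<close> of the integers modulo 4. It changes sign under
  \<open>a \<mapsto> a + 2\<close>, which is all that the orthogonality relations need.\<close>

definition re_char :: "4 \<Rightarrow> int" where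
  "re_char a = (if a = 0 then 1 else if a = 2 then - 1 else 0)"

lemma re_char_add_2: "re_char (a + 2) = - re_char a"
  by (cases a rule: four_cases) (auto simp: re_char_def)

text \<open>If \<open>f\<close> does not vanish on \<open>S\<close>, a nonzero value or its double
  is 2, attained at some \<open>b\<close>. Translation by \<open>b\<close> permutes \<open>S\<close>
  and negates each summand, so the sum equals its own negative.\<close>

lemma sum_re_char:
  assumes "additive f" "add_subgroup S" "finite S"
  shows "(\<Sum>x\<in>S. re_char (f x)) = (if \<forall>x\<in>S. f x = 0 then int (card S) else 0)"
proof (cases "\<forall>x\<in>S. f x = 0")
  case True
  then show ?thesis by (simp add: re_char_def)
next
  case False
  interpret additive f by fact
  obtain a where a: "a \<in> S" "f a \<noteq> 0"
    using False by auto
  have "f a = 2 \<or> f (a + a) = 2"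
    using a(2) by (cases "f a" rule: four_cases) (auto simp: add)
  then obtain b where b: "b \<in> S" "f b = 2"
    using a(1) add_subgroup_add[OF assms(2)] by blast
  have "bij_betw (\<lambda>x. x + b) S S"
    by (rule bij_betw_byWitness[where f' = "\<lambda>x. x - b"])
       (use assms(2) b in \<open>auto simp: add_subgroup_add add_subgroup_diff\<close>)
  then have "(\<Sum>x\<in>S. re_char (f x)) = (\<Sum>x\<in>S. re_char (f (x + b)))"
    by (simp add: sum.reindex_bij_betw[where g = "\<lambda>x. re_char (f x)"])
  also have "\<dots> = - (\<Sum>x\<in>S. re_char (f x))"
    by (simp add: add b(2) re_char_add_2 sum_negf)
  finally show ?thesis
    unfolding if_not_P[OF False] by simp
qed

section \<open>Size of the dual, biduality and duals of sums\<close>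

lemma additive_dual_subset: "additive_dual \<alpha> \<beta> C \<subseteq> carrier (Z2Z4 \<alpha> \<beta>)"
  by (auto simp: additive_dual_def)

lemma add_subgroup_additive_dual: "add_subgroup (additive_dual \<alpha> \<beta> C)"
  using add_subgroup_carrier[of \<alpha> \<beta>]
  by (simp add: additive_dual_def add_subgroup_def
      additive.zero[OF additive_z2z4_inner] additive.diff[OF additive_z2z4_inner])

text \<open>The sum of \<open>re_char\<close> over all pairs from the group and the code is
  evaluated in both orders. Summing over \<open>C\<close> first leaves \<open>card C\<close> for
  each dual vector; summing over the group first leaves only \<open>y = 0\<close>, by
  nondegeneracy.\<close>

lemma card_additive_dual:
  assumes "add_subgroup C" "C \<subseteq> carrier (Z2Z4 \<alpha> \<beta>)"
  shows "card C * card (additive_dual \<alpha> \<beta> C) = 2 ^ (\<alpha> + 2 * \<beta>)"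
proof -
  let ?G = "carrier (Z2Z4 \<alpha> \<beta>)"
  have fin: "finite C" "finite ?G"
    using assms(2) finite_carrier_Z2Z4 finite_subset by blast+
  have "int (card C * card (additive_dual \<alpha> \<beta> C)) =
      (\<Sum>x\<in>?G. if x \<in> additive_dual \<alpha> \<beta> C then int (card C) else 0)"
    using fin by (simp add: sum.If_cases Int_absorb1 additive_dual_subset)
  also have "\<dots> = (\<Sum>x\<in>?G. \<Sum>y\<in>C. re_char (z2z4_inner \<alpha> \<beta> y x))"
    using sum_re_char[OF additive_z2z4_inner assms(1) fin(1), of \<alpha> \<beta>]
    by (intro sum.cong refl) (simp add: additive_dual_def z2z4_inner_commute)
  also have "\<dots> = (\<Sum>y\<in>C. \<Sum>x\<in>?G. re_char (z2z4_inner \<alpha> \<beta> x y))"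
    by (subst sum.swap) (simp only: z2z4_inner_commute)
  also have "\<dots> = (\<Sum>y\<in>C. if y = 0 then int (card ?G) else 0)"
  proof (intro sum.cong refl)
    fix y assume "y \<in> C"
    then have y: "y \<in> ?G"
      using assms(2) by auto
    have "z2z4_inner \<alpha> \<beta> x 0 = 0" for x
      unfolding z2z4_inner_commute[of \<alpha> \<beta> _ 0] by (rule additive.zero[OF additive_z2z4_inner])
    then have "(\<forall>x\<in>?G. z2z4_inner \<alpha> \<beta> x y = 0) \<longleftrightarrow> y = 0"
      using z2z4_inner_nondegenerate[OF y] by blast
    then show "(\<Sum>x\<in>?G. re_char (z2z4_inner \<alpha> \<beta> x y)) = (if y = 0 then int (card ?G) else 0)"
      by (simp add: sum_re_char[OF additive_z2z4_inner add_subgroup_carrier fin(2)])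
  qed
  also have "\<dots> = int (card ?G)"
    using fin add_subgroup_zero[OF assms(1)] by simp
  finally show ?thesis
    using card_carrier_Z2Z4[of \<alpha> \<beta>] by linarith
qed

text \<open>Symmetry of the inner product gives one inclusion, and the product formula, applied to
  \<open>C\<close> and to its dual, gives equal sizes.\<close>

lemma additive_dual_dual:
  assumes "add_subgroup C" "C \<subseteq> carrier (Z2Z4 \<alpha> \<beta>)"
  shows "additive_dual \<alpha> \<beta> (additive_dual \<alpha> \<beta> C) = C"
proof (rule card_subset_eq[symmetric])
  show "finite (additive_dual \<alpha> \<beta> (additive_dual \<alpha> \<beta> C))"
    by (rule finite_subset[OF additive_dual_subset finite_carrier_Z2Z4])
  show "C \<subseteq> additive_dual \<alpha> \<beta> (additive_dual \<alpha> \<beta> C)"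
    using assms(2) by (auto simp: additive_dual_def z2z4_inner_commute)
  have "card (additive_dual \<alpha> \<beta> C) * card (additive_dual \<alpha> \<beta> (additive_dual \<alpha> \<beta> C)) =
      card (additive_dual \<alpha> \<beta> C) * card C"
    using card_additive_dual[OF assms]
      card_additive_dual[OF add_subgroup_additive_dual additive_dual_subset, of \<alpha> \<beta> C]
    by (simp add: mult.commute)
  \<comment> \<open>A factor of a power of two is nonzero, so it may be cancelled.\<close>
  moreover have "card (additive_dual \<alpha> \<beta> C) \<noteq> 0"
    using card_additive_dual[OF assms] by (metis mult_0_right power_not_zero zero_neq_numeral)
  ultimately show "card C = card (additive_dual \<alpha> \<beta> (additive_dual \<alpha> \<beta> C))"
    by simp
qed

lemma additive_dual_sum:
  assumes "0 \<in> D" "0 \<in> E"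
  shows "additive_dual \<alpha> \<beta> ((\<lambda>(x, y). x + y) ` (D \<times> E)) = additive_dual \<alpha> \<beta> D \<inter> additive_dual \<alpha> \<beta> E"
    (is "?L = ?R")
proof
  have *: "z2z4_inner \<alpha> \<beta> x (y + z) = z2z4_inner \<alpha> \<beta> x y + z2z4_inner \<alpha> \<beta> x z" for x y z
    unfolding z2z4_inner_commute[of \<alpha> \<beta> x] by (rule additive.add[OF additive_z2z4_inner])
  show "?R \<subseteq> ?L"
    by (auto simp: additive_dual_def *)
  show "?L \<subseteq> ?R"
    using subset_sum_image[OF assms] unfolding additive_dual_def by blast
qed

section \<open>The bounds on the intersection\<close>

theorem theorem3:
  fixes \<alpha> \<beta> \<gamma>\<^sub>1 \<delta>\<^sub>1 \<kappa>\<^sub>1 \<gamma>\<^sub>2 \<delta>\<^sub>2 \<kappa>\<^sub>2 \<mu> :: nat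
    and C\<^sub>1 C\<^sub>2 :: "z2z4_vec set"
  assumes "additive_code \<alpha> \<beta> C\<^sub>1" and "additive_code \<alpha> \<beta> C\<^sub>2"
    and "has_dual_type \<alpha> \<beta> C\<^sub>1 \<gamma>\<^sub>1 \<delta>\<^sub>1 \<kappa>\<^sub>1" and "has_dual_type \<alpha> \<beta> C\<^sub>2 \<gamma>\<^sub>2 \<delta>\<^sub>2 \<kappa>\<^sub>2"
    and "\<mu> = Min {\<gamma>\<^sub>1 + \<gamma>\<^sub>2 + 2 * (\<delta>\<^sub>1 + \<delta>\<^sub>2), \<gamma>\<^sub>1 + \<gamma>\<^sub>2 + \<delta>\<^sub>1 + \<delta>\<^sub>2 + \<beta>,
                  \<delta>\<^sub>1 + \<delta>\<^sub>2 + \<alpha> + \<beta>, \<alpha> + 2 * \<beta>}"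
  shows "2 powi (int \<alpha> + 2 * int \<beta> - int \<mu>) \<le> real (intersection_number C\<^sub>1 C\<^sub>2) \<and>
         real (intersection_number C\<^sub>1 C\<^sub>2) \<le>
         2 powi (int \<alpha> + 2 * int \<beta> - int (max (\<kappa>\<^sub>1 + \<delta>\<^sub>1) (\<kappa>\<^sub>2 + \<delta>\<^sub>2)) - int (max \<delta>\<^sub>1 \<delta>\<^sub>2))"
proof -
  let ?G = "carrier (Z2Z4 \<alpha> \<beta>)" and ?sum = "\<lambda>(x, y). x + y :: z2z4_vec"
  define D\<^sub>1 where "D\<^sub>1 = additive_dual \<alpha> \<beta> C\<^sub>1"
  define D\<^sub>2 where "D\<^sub>2 = additive_dual \<alpha> \<beta> C\<^sub>2"
  define S where "S = ?sum ` (D\<^sub>1 \<times> D\<^sub>2)"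
  have D: "add_subgroup D\<^sub>1" "add_subgroup D\<^sub>2" "D\<^sub>1 \<subseteq> ?G" "D\<^sub>2 \<subseteq> ?G"
    by (simp_all only: D\<^sub>1_def D\<^sub>2_def add_subgroup_additive_dual additive_dual_subset)
  have types: "has_type \<alpha> \<beta> D\<^sub>1 \<gamma>\<^sub>1 \<delta>\<^sub>1 \<kappa>\<^sub>1" "has_type \<alpha> \<beta> D\<^sub>2 \<gamma>\<^sub>2 \<delta>\<^sub>2 \<kappa>\<^sub>2"
    using assms(3,4) by (auto simp: D\<^sub>1_def D\<^sub>2_def has_dual_type_def)
  have fin: "finite D\<^sub>1" "finite D\<^sub>2"
    using D finite_carrier_Z2Z4 finite_subset by blast+
  have S: "add_subgroup S" "finite S" "S \<subseteq> ?G"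
    unfolding S_def using fin
    by (simp_all only: add_subgroup_image[OF additive_sum add_subgroup_Times[OF D(1,2)]]
        sum_image_subset[OF add_subgroup_carrier D(3,4)] finite_imageI finite_cartesian_product)
  note zero = D(1,2)[THEN add_subgroup_zero]
  have sub: "D\<^sub>1 \<subseteq> S" "D\<^sub>2 \<subseteq> S"
    unfolding S_def by (fact subset_sum_image[OF zero])+
  \<comment> \<open>Biduality recovers the codes from \<open>D\<^sub>1\<close> and
    \<open>D\<^sub>2\<close>, so their intersection is the dual of \<open>S\<close>.\<close>
  have dual: "additive_dual \<alpha> \<beta> D\<^sub>1 = C\<^sub>1" "additive_dual \<alpha> \<beta> D\<^sub>2 = C\<^sub>2"
    unfolding D\<^sub>1_def D\<^sub>2_def using assms(1,2) by (simp_all add: additive_code_iff additive_dual_dual)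
  have "additive_dual \<alpha> \<beta> S = C\<^sub>1 \<inter> C\<^sub>2"
    unfolding S_def additive_dual_sum[OF zero] dual ..
  then have card_S: "card S * intersection_number C\<^sub>1 C\<^sub>2 = 2 ^ (\<alpha> + 2 * \<beta>)"
    using card_additive_dual[OF S(1,3)] by (simp add: intersection_number_def)

  let ?t = "card (two_torsion S)" and ?d = "card (doubles S)"
  have S_eq: "card S = ?d * ?t"
    using card_doubles_two_torsion[OF S(1,2)] .
  have t1: "?t \<le> 2 ^ (\<gamma>\<^sub>1 + \<delta>\<^sub>1 + (\<gamma>\<^sub>2 + \<delta>\<^sub>2))"
  proof -
    \<comment> \<open>A two-torsion element of \<open>S\<close> need not be a sum of two-torsion
      elements of the summands, hence the appeal to the index argument for the addition map.\<close>
    have "?t \<le> card (two_torsion (D\<^sub>1 \<times> D\<^sub>2))"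
      unfolding S_def using D fin
      by (intro card_two_torsion_image_le additive_sum add_subgroup_Times) auto
    then show ?thesis
      unfolding two_torsion_Times card_cartesian_product
      by (simp add: types[THEN has_type_card_two_torsion] power_add)
  qed
  have d1: "?d \<le> 2 ^ (\<delta>\<^sub>1 + \<delta>\<^sub>2)"
  proof -
    have "?d \<le> card (doubles (D\<^sub>1 \<times> D\<^sub>2))"
      unfolding S_def doubles_image[OF additive_sum] using fin
      by (intro card_image_le) auto
    then show ?thesis
      unfolding doubles_Times card_cartesian_product
      by (simp add: types[THEN has_type_card_doubles] power_add)
  qed
  have t2: "?t \<le> 2 ^ (\<alpha> + \<beta>)"
    using card_two_torsion_mono[OF S(3) finite_carrier_Z2Z4] unfolding card_two_torsion_Z2Z4 .
  have "doubles S \<subseteq> two_torsion (carrier (Z2Z4 0 \<beta>))"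
    using doubles_carrier_subset S(3) by blast
  then have d2: "?d \<le> 2 ^ \<beta>"
    using card_mono[of "two_torsion (carrier (Z2Z4 0 \<beta>))"] finite_carrier_Z2Z4[of 0 \<beta>]
      card_two_torsion_Z2Z4[of 0 \<beta>] by simp
  \<comment> \<open>The minimum is attained, so it is enough to bound \<open>card S\<close> for each
    of the four exponents.\<close>
  have "\<mu> \<in> {\<gamma>\<^sub>1 + \<gamma>\<^sub>2 + 2 * (\<delta>\<^sub>1 + \<delta>\<^sub>2), \<gamma>\<^sub>1 + \<gamma>\<^sub>2 + \<delta>\<^sub>1 + \<delta>\<^sub>2 + \<beta>,
                  \<delta>\<^sub>1 + \<delta>\<^sub>2 + \<alpha> + \<beta>, \<alpha> + 2 * \<beta>}"
    unfolding assms(5) by (intro Min_in) auto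
  moreover have "card S \<le> 2 ^ (d + t)" if "?d \<le> 2 ^ d" "?t \<le> 2 ^ t" for d t
    unfolding S_eq power_add using that by (rule mult_le_mono)
  note this[OF d1 t1] this[OF d2 t1] this[OF d1 t2] this[OF d2 t2]
  \<comment> \<open>The names \<open>lower\<close> and \<open>upper\<close> refer to the bounds on
    the intersection, which is inversely proportional to \<open>card S\<close>.\<close>
  ultimately have lower: "card S \<le> 2 ^ \<mu>"
    by (elim insertE emptyE) (simp_all add: algebra_simps mult_2_right)

  have "2 ^ (\<kappa>\<^sub>1 + \<delta>\<^sub>1) \<le> ?t" "2 ^ (\<kappa>\<^sub>2 + \<delta>\<^sub>2) \<le> ?t"
    using types[THEN has_type_kappa] sub[THEN card_two_torsion_mono] S(2) order_trans by blast+
  then have "2 ^ max (\<kappa>\<^sub>1 + \<delta>\<^sub>1) (\<kappa>\<^sub>2 + \<delta>\<^sub>2) \<le> ?t"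
    by (auto simp: max_def)
  moreover have "2 ^ \<delta>\<^sub>1 \<le> ?d" "2 ^ \<delta>\<^sub>2 \<le> ?d"
    using sub[THEN card_doubles_mono] S(2) unfolding types[THEN has_type_card_doubles] by blast+
  then have "2 ^ max \<delta>\<^sub>1 \<delta>\<^sub>2 \<le> ?d"
    by (auto simp: max_def)
  ultimately have upper: "2 ^ (max (\<kappa>\<^sub>1 + \<delta>\<^sub>1) (\<kappa>\<^sub>2 + \<delta>\<^sub>2) + max \<delta>\<^sub>1 \<delta>\<^sub>2) \<le> card S"
    unfolding S_eq power_add by (simp add: mult.commute mult_le_mono)

  \<comment> \<open>The integer exponents avoid truncated subtraction; as quotients of natural
    powers they can be compared with the formula for the intersection number.\<close>
  have powi: "2 powi (int \<alpha> + 2 * int \<beta> - int k) = (2 ^ (\<alpha> + 2 * \<beta>) / 2 ^ k :: real)" for k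
  proof -
    have eq: "int \<alpha> + 2 * int \<beta> = int (\<alpha> + 2 * \<beta>)"
      by simp
    show ?thesis
      unfolding eq by (simp add: power_int_diff del: of_nat_add of_nat_mult)
  qed
  have pos: "real (card S) > 0"
    using card_S by (cases "card S = 0") auto
  have eq: "real (intersection_number C\<^sub>1 C\<^sub>2) = 2 ^ (\<alpha> + 2 * \<beta>) / real (card S)"
    using arg_cong[OF card_S, of real] pos by (simp add: field_simps)
  have "real (card S) \<le> 2 ^ \<mu>" "2 ^ (max (\<kappa>\<^sub>1 + \<delta>\<^sub>1) (\<kappa>\<^sub>2 + \<delta>\<^sub>2) + max \<delta>\<^sub>1 \<delta>\<^sub>2) \<le> real (card S)"
    using lower upper by (metis of_nat_le_iff of_nat_power of_nat_numeral)+
  then show ?thesis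
    \<comment> \<open>Merging the two subtracted maxima into one natural number makes
      \<open>powi\<close> apply to the upper bound as well.\<close>
    unfolding diff_diff_eq of_nat_add[symmetric] powi eq using pos
    by (intro conjI divide_left_mono) auto
qed

end
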